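(* Let $X$ be a Tychonoff space. Then the zero-cozero topology on $\mathcal{H}(X)$ is the relativisation to $\mathcal{H}(X)$ of the compact-open topology of $\mathcal{H}(\beta X)$, where $\mathcal{H}(X)$ is regarded as a subgroup of $\mathcal{H}(\beta X)$ by extending each self-homeomorphism of $X$ to $\beta X$.
   Context: For a space $Y$, $\mathcal{H}(Y)$ is the group of all self-homeomorphisms of $Y$. $\beta X$ is the Stone–Čech compactification of $X$. Every $h\in\mathcal{H}(X)$ extends uniquely to a self-homeomorphism of $\beta X$, and this gives an embedding of $\mathcal{H}(X)$ as a subgroup of $\mathcal{H}(\beta X)$. A set $F\subseteq X$ is a zero set if $F=\{x\in X: f(x)=0\}$ for some continuous $f:X\to\mathbb{R}$; a cozero set is the complement of a zero set. The zero-cozero topology on $\mathcal{H}(X)$ is the topology generated by (having as subbase) the sets $[A,U]=\{h\in\mathcal{H}(X): h(A)\subset U\}$, where $A$ is a zero set of $X$ and $U$ is a cozero set of $X$; $\mathcal{H}(X)$ with this topology is denoted $\mathcal{H}_{zc}(X)$. The compact-open topology on $\mathcal{H}(\beta X)$ has as subbase the sets $\{h\in\mathcal{H}(\beta X): h(K)\subset V\}$ with $K\subseteq\beta X$ compact and $V\subseteq\beta X$ open. *)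

theory Defs
  imports "HOL-Analysis.Analysis"
begin

section \<open>Self-homeomorphisms and topologies on them\<close>

text \<open>Spaces are abstract topologies on a carrier \<open>topspace X\<close>. Maps are taken extensional on the
  carrier, so that two self-homeomorphisms are equal iff they agree on all points of the space;
  the group operation is \<open>compose (topspace X)\<close>.\<close>

definition self_homeos :: "'a topology \<Rightarrow> ('a \<Rightarrow> 'a) set" where
  "self_homeos X = {h \<in> extensional (topspace X). homeomorphic_map X X h}"

definition zero_set_in :: "'a topology \<Rightarrow> 'a set \<Rightarrow> bool" where
  "zero_set_in X F \<longleftrightarrow> (\<exists>f. continuous_map X euclideanreal f \<and> F = {x \<in> topspace X. f x = 0})"

definition cozero_set_in :: "'a topology \<Rightarrow> 'a set \<Rightarrow> bool" where
  "cozero_set_in X U \<longleftrightarrow> (\<exists>F. zero_set_in X F \<and> U = topspace X - F)"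

text \<open>Both subbases below contain the whole of \<open>self_homeos\<close> (take the source set empty), so the
  generated topologies have carrier \<open>self_homeos X\<close>.\<close>

definition zero_cozero_topology :: "'a topology \<Rightarrow> ('a \<Rightarrow> 'a) topology" where
  "zero_cozero_topology X = topology_generated_by
     {{h \<in> self_homeos X. h ` A \<subseteq> U} | A U. zero_set_in X A \<and> cozero_set_in X U}"

definition compact_open_topology :: "'a topology \<Rightarrow> ('a \<Rightarrow> 'a) topology" where
  "compact_open_topology Y = topology_generated_by
     {{h \<in> self_homeos Y. h ` K \<subseteq> V} | K V. compactin Y K \<and> openin Y V}"


section \<open>The Stone-Cech compactification\<close>

text \<open>\<open>\<beta>X\<close> is the closure of the image of \<open>X\<close> under evaluation in the cube \<open>[0,1]\<^sup>C\<close>, where \<open>C\<close> is the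
  set of all continuous maps \<open>X \<rightarrow> [0,1]\<close>. Its defining properties are proved below.\<close>

definition unit_functions :: "'a topology \<Rightarrow> ('a \<Rightarrow> real) set" where
  "unit_functions X = {f \<in> extensional (topspace X). continuous_map X (top_of_set {0..1}) f}"

definition stone_cech_embed :: "'a topology \<Rightarrow> 'a \<Rightarrow> ('a \<Rightarrow> real) \<Rightarrow> real" where
  "stone_cech_embed X x = (\<lambda>f\<in>unit_functions X. f x)"

definition unit_cube :: "'a topology \<Rightarrow> (('a \<Rightarrow> real) \<Rightarrow> real) topology" where
  "unit_cube X = product_topology (\<lambda>f. top_of_set {0..1}) (unit_functions X)"

definition stone_cech :: "'a topology \<Rightarrow> (('a \<Rightarrow> real) \<Rightarrow> real) topology" where
  "stone_cech X = subtopology (unit_cube X) (unit_cube X closure_of (stone_cech_embed X ` topspace X))"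

text \<open>The extension to \<open>\<beta>X\<close> of a self-homeomorphism of \<open>X\<close>; it exists and is unique by
  \<open>stone_cech_extension_ex1\<close> below.\<close>

definition stone_cech_extension ::
    "'a topology \<Rightarrow> ('a \<Rightarrow> 'a) \<Rightarrow> (('a \<Rightarrow> real) \<Rightarrow> real) \<Rightarrow> (('a \<Rightarrow> real) \<Rightarrow> real)" where
  "stone_cech_extension X h = (THE g. g \<in> self_homeos (stone_cech X) \<and>
     (\<forall>x\<in>topspace X. g (stone_cech_embed X x) = stone_cech_embed X (h x)))"


section \<open>The definitions are meaningful\<close>

lemma topspace_zero_cozero_topology: "topspace (zero_cozero_topology X) = self_homeos X"
proof -
  let ?S = "{{h \<in> self_homeos X. h ` A \<subseteq> U} | A U. zero_set_in X A \<and> cozero_set_in X U}"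
  have z: "zero_set_in X {}"
    unfolding zero_set_in_def by (rule exI[of _ "\<lambda>_. 1"]) simp
  then have c: "cozero_set_in X (topspace X)"
    unfolding cozero_set_in_def by (intro exI[of _ "{}"]) simp
  have "self_homeos X \<in> ?S"
    by (rule CollectI, rule exI[of _ "{}"], rule exI[of _ "topspace X"]) (simp add: z c)
  moreover have "\<Union> ?S \<subseteq> self_homeos X"
    by (rule Union_least) auto
  ultimately show ?thesis
    unfolding zero_cozero_topology_def topology_generated_by_topspace
    by (intro equalityI Union_upper)
qed

lemma topspace_compact_open_topology: "topspace (compact_open_topology Y) = self_homeos Y"
proof -
  let ?S = "{{h \<in> self_homeos Y. h ` K \<subseteq> V} | K V. compactin Y K \<and> openin Y V}"
  have "self_homeos Y \<in> ?S"
    by (rule CollectI, rule exI[of _ "{}"], rule exI[of _ "{}"]) simp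
  moreover have "\<Union> ?S \<subseteq> self_homeos Y"
    by (rule Union_least) auto
  ultimately show ?thesis
    unfolding compact_open_topology_def topology_generated_by_topspace
    by (intro equalityI Union_upper)
qed

lemma compact_unit_cube: "compact_space (unit_cube X)"
  unfolding unit_cube_def
  by (simp add: compact_space_product_topology compact_space_subtopology)

lemma Hausdorff_unit_cube: "Hausdorff_space (unit_cube X)"
  unfolding unit_cube_def
  by (simp add: Hausdorff_space_product_topology Hausdorff_space_subtopology)

lemma compact_stone_cech: "compact_space (stone_cech X)"
  unfolding stone_cech_def
  by (simp add: closedin_compact_space compact_space_subtopology compact_unit_cube)

lemma Hausdorff_stone_cech: "Hausdorff_space (stone_cech X)"
  unfolding stone_cech_def by (simp add: Hausdorff_space_subtopology Hausdorff_unit_cube)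

lemma continuous_embed_cube: "continuous_map X (unit_cube X) (stone_cech_embed X)"
  unfolding unit_cube_def stone_cech_embed_def
  by (auto simp: continuous_map_componentwise unit_functions_def)

lemma embed_image_cube: "stone_cech_embed X ` topspace X \<subseteq> topspace (unit_cube X)"
  by (rule continuous_map_image_subset_topspace[OF continuous_embed_cube])

lemma topspace_stone_cech:
  "topspace (stone_cech X) = unit_cube X closure_of (stone_cech_embed X ` topspace X)"
  unfolding stone_cech_def topspace_subtopology
  by (rule Int_absorb1[OF closure_of_subset_topspace])

lemma embed_image: "stone_cech_embed X ` topspace X \<subseteq> topspace (stone_cech X)"
  unfolding topspace_stone_cech by (rule closure_of_subset[OF embed_image_cube])

lemma stone_cech_subtopology: "stone_cech X = subtopology (unit_cube X) (topspace (stone_cech X))"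
  unfolding topspace_stone_cech by (rule stone_cech_def)

lemma continuous_stone_cech_embed: "continuous_map X (stone_cech X) (stone_cech_embed X)"
  by (subst stone_cech_subtopology, rule continuous_map_into_subtopology[OF continuous_embed_cube])
    (use embed_image[of X] in auto)

lemma dense_stone_cech_embed:
  "stone_cech X closure_of (stone_cech_embed X ` topspace X) = topspace (stone_cech X)"
proof -
  let ?E = "stone_cech_embed X ` topspace X" and ?C = "topspace (stone_cech X)"
  have "stone_cech X closure_of ?E = ?C \<inter> (unit_cube X closure_of (?C \<inter> ?E))"
    by (subst stone_cech_subtopology) (rule closure_of_subtopology)
  also have "?C \<inter> ?E = ?E"
    by (rule Int_absorb1[OF embed_image])
  finally show ?thesis
    unfolding topspace_stone_cech by blast
qed

lemma embedding_stone_cech_embed: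
  assumes "completely_regular_space X" "Hausdorff_space X"
  shows "embedding_map X (stone_cech X) (stone_cech_embed X)"
proof -
  have bnd: "bounded (f ` topspace X)" if "f \<in> topspace X \<rightarrow> {0..1::real}" for f
    by (rule bounded_subset[OF bounded_closed_interval]) (use that in \<open>simp add: image_subset_iff_funcset\<close>)
  have eq: "unit_functions X = mspace (submetric (cfunspace X euclidean_metric) {f. f \<in> topspace X \<rightarrow> {0..1}})"
    by (rule set_eqI, simp add: unit_functions_def continuous_map_in_subtopology, safe, rule bnd)
  have "embedding_map X (unit_cube X) (stone_cech_embed X)"
    unfolding unit_cube_def stone_cech_embed_def[abs_def] eq
    by (rule completely_regular_space_cube_embedding_explicit[OF assms])
  then have "embedding_map X (subtopology (unit_cube X) (topspace (stone_cech X))) (stone_cech_embed X)"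
    by (simp only: embedding_map_in_subtopology embed_image simp_thms)
  then show ?thesis
    by (subst stone_cech_subtopology)
qed

lemma stone_cech_map_unique:
  assumes "Hausdorff_space Y" "continuous_map (stone_cech X) Y f" "continuous_map (stone_cech X) Y g"
    and "\<And>x. x \<in> topspace X \<Longrightarrow> f (stone_cech_embed X x) = g (stone_cech_embed X x)"
    and "p \<in> topspace (stone_cech X)"
  shows "f p = g p"
proof (rule forall_in_closure_of_eq[where f = f and g = g and x = p, OF _ assms(1-3)])
  show "p \<in> stone_cech X closure_of (stone_cech_embed X ` topspace X)"
    using assms(5) by (simp only: dense_stone_cech_embed)
  show "f x = g x" if "x \<in> stone_cech_embed X ` topspace X" for x
    using that assms(4) by (elim imageE) simp
qed

lemma stone_cech_functorial:
  assumes k: "continuous_map X Y k"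
  obtains g where "continuous_map (stone_cech X) (stone_cech Y) g"
    "\<And>x. x \<in> topspace X \<Longrightarrow> g (stone_cech_embed X x) = stone_cech_embed Y (k x)"
proof
  define r where "r f = restrict (f \<circ> k) (topspace X)" for f :: "'b \<Rightarrow> real"
  define g where "g p = (\<lambda>f\<in>unit_functions Y. p (r f))" for p :: "('a \<Rightarrow> real) \<Rightarrow> real"
  have kX: "k x \<in> topspace Y" if "x \<in> topspace X" for x
    using k that by (auto simp: continuous_map_def)
  have r: "r f \<in> unit_functions X" if "f \<in> unit_functions Y" for f
  proof -
    have "continuous_map X (top_of_set {0..1}) (f \<circ> k)"
      using that k continuous_map_compose unfolding unit_functions_def by blast
    then have "continuous_map X (top_of_set {0..1}) (r f)"
      by (rule continuous_map_eq) (simp add: r_def)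
    then show ?thesis by (simp add: unit_functions_def r_def)
  qed
  show ge: "g (stone_cech_embed X x) = stone_cech_embed Y (k x)" if "x \<in> topspace X" for x
    using that r by (auto simp: g_def stone_cech_embed_def r_def fun_eq_iff)
  have gc: "continuous_map (unit_cube X) (unit_cube Y) g"
    unfolding unit_cube_def continuous_map_componentwise
  proof (intro conjI ballI)
    show "g ` topspace (product_topology (\<lambda>f. top_of_set {0..1}) (unit_functions X))
        \<subseteq> extensional (unit_functions Y)"
      by (auto simp: g_def)
    fix f assume f: "f \<in> unit_functions Y"
    have "continuous_map (product_topology (\<lambda>f. top_of_set {0..1}) (unit_functions X))
            (top_of_set {0..1}) (\<lambda>p. p (r f))"
      using continuous_map_product_projection[OF r[OF f]] .
    then show "continuous_map (product_topology (\<lambda>f. top_of_set {0..1}) (unit_functions X))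
            (top_of_set {0..1}) (\<lambda>p. g p f)"
      using f by (simp add: g_def)
  qed
  have "g ` (stone_cech_embed X ` topspace X) \<subseteq> stone_cech_embed Y ` topspace Y"
    using ge kX by auto
  then have "g ` topspace (stone_cech X) \<subseteq> topspace (stone_cech Y)"
    unfolding topspace_stone_cech
    by (rule order_trans[OF continuous_map_image_closure_subset[OF gc] closure_of_mono])
  then show "continuous_map (stone_cech X) (stone_cech Y) g"
    unfolding image_subset_iff_funcset
    by (subst stone_cech_subtopology[of Y], intro continuous_map_into_subtopology)
      (subst stone_cech_subtopology, rule continuous_map_from_subtopology[OF gc], assumption)
qed

text \<open>The universal property: continuous maps from \<open>X\<close> to compact Hausdorff spaces extend to
  \<open>\<beta>X\<close> (uniquely, by \<open>stone_cech_map_unique\<close>).\<close>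

lemma stone_cech_universal:
  assumes K: "compact_space K" "Hausdorff_space K" and f: "continuous_map X K f"
  obtains g where "continuous_map (stone_cech X) K g"
    "\<And>x. x \<in> topspace X \<Longrightarrow> g (stone_cech_embed X x) = f x"
proof -
  let ?e = "stone_cech_embed K"
  have "completely_regular_space K"
    using K compact_Hausdorff_or_regular_imp_normal_space normal_imp_completely_regular_space
    by blast
  then have emb: "embedding_map K (stone_cech K) ?e"
    using K(2) by (rule embedding_stone_cech_embed)
  have "compactin (stone_cech K) (?e ` topspace K)"
    using image_compactin[OF _ continuous_stone_cech_embed] K(1) unfolding compact_space_def by blast
  then have "closedin (stone_cech K) (?e ` topspace K)"
    by (rule compactin_imp_closedin[OF Hausdorff_stone_cech])
  then have "?e ` topspace K = topspace (stone_cech K)"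
    using dense_stone_cech_embed[of K] closure_of_closedin by metis
  then have "homeomorphic_map K (stone_cech K) ?e"
    using emb by (simp add: embedding_map_def)
  then obtain d where d: "homeomorphic_maps K (stone_cech K) ?e d"
    using homeomorphic_map_maps by blast
  obtain g where g: "continuous_map (stone_cech X) (stone_cech K) g"
    "\<And>x. x \<in> topspace X \<Longrightarrow> g (stone_cech_embed X x) = ?e (f x)"
    using stone_cech_functorial[OF f] by blast
  show ?thesis
  proof
    show "continuous_map (stone_cech X) K (d \<circ> g)"
      using d g(1) continuous_map_compose unfolding homeomorphic_maps_def by blast
    show "(d \<circ> g) (stone_cech_embed X x) = f x" if "x \<in> topspace X" for x
      using d g(2)[OF that] f that unfolding homeomorphic_maps_def continuous_map_def by auto
  qed
qed

lemma self_homeos_iff: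
  "h \<in> self_homeos X \<longleftrightarrow> h \<in> extensional (topspace X) \<and> (\<exists>h'. homeomorphic_maps X X h h')"
  by (auto simp: self_homeos_def homeomorphic_map_maps)

theorem stone_cech_extension_ex1:
  assumes h: "h \<in> self_homeos X"
  shows "\<exists>!g. g \<in> self_homeos (stone_cech X) \<and>
     (\<forall>x\<in>topspace X. g (stone_cech_embed X x) = stone_cech_embed X (h x))"
proof (rule ex_ex1I)
  let ?e = "stone_cech_embed X" and ?B = "stone_cech X"
  obtain h' where hh: "homeomorphic_maps X X h h'"
    using h self_homeos_iff by blast
  then have c: "continuous_map X X h" "continuous_map X X h'"
    and i: "\<And>x. x \<in> topspace X \<Longrightarrow> h' (h x) = x" "\<And>x. x \<in> topspace X \<Longrightarrow> h (h' x) = x"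
    and m: "\<And>x. x \<in> topspace X \<Longrightarrow> h x \<in> topspace X" "\<And>x. x \<in> topspace X \<Longrightarrow> h' x \<in> topspace X"
    unfolding homeomorphic_maps_def continuous_map_def by auto
  obtain g where g: "continuous_map ?B ?B g" "\<And>x. x \<in> topspace X \<Longrightarrow> g (?e x) = ?e (h x)"
    using stone_cech_functorial[OF c(1)] by blast
  obtain g' where g': "continuous_map ?B ?B g'" "\<And>x. x \<in> topspace X \<Longrightarrow> g' (?e x) = ?e (h' x)"
    using stone_cech_functorial[OF c(2)] by blast
  have "(g' \<circ> g) p = id p" if "p \<in> topspace ?B" for p
    by (rule stone_cech_map_unique[OF Hausdorff_stone_cech continuous_map_compose[OF g(1) g'(1)]
          continuous_map_id _ that]) (simp add: g g' i m)
  moreover have "(g \<circ> g') p = id p" if "p \<in> topspace ?B" for p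
    by (rule stone_cech_map_unique[OF Hausdorff_stone_cech continuous_map_compose[OF g'(1) g(1)]
          continuous_map_id _ that]) (simp add: g g' i m)
  ultimately have "homeomorphic_map ?B ?B g"
    using g(1) g'(1) unfolding homeomorphic_map_maps homeomorphic_maps_def by auto
  then have "homeomorphic_map ?B ?B (restrict g (topspace ?B))"
    by (rule homeomorphic_map_eq) simp
  moreover have "?e x \<in> topspace ?B" if "x \<in> topspace X" for x
    using embed_image[of X] that by blast
  ultimately show "\<exists>g. g \<in> self_homeos ?B \<and> (\<forall>x\<in>topspace X. g (?e x) = ?e (h x))"
    using g(2) by (intro exI[of _ "restrict g (topspace ?B)"]) (simp add: self_homeos_def)
next
  let ?e = "stone_cech_embed X" and ?B = "stone_cech X"
  fix g k
  assume g: "g \<in> self_homeos ?B \<and> (\<forall>x\<in>topspace X. g (?e x) = ?e (h x))"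
    and k: "k \<in> self_homeos ?B \<and> (\<forall>x\<in>topspace X. k (?e x) = ?e (h x))"
  have "g p = k p" if "p \<in> topspace ?B" for p
    by (rule stone_cech_map_unique[where f = g and g = k, OF Hausdorff_stone_cech[of X] _ _ _ that])
      (use g k in \<open>auto simp: self_homeos_def homeomorphic_imp_continuous_map\<close>)
  then show "g = k"
    using g k by (intro extensionalityI[of g "topspace ?B" k]) (auto simp: self_homeos_def)
qed

lemma stone_cech_extension:
  assumes "h \<in> self_homeos X"
  shows stone_cech_extension_in: "stone_cech_extension X h \<in> self_homeos (stone_cech X)"
    and stone_cech_extension_embed: "x \<in> topspace X \<Longrightarrow>
      stone_cech_extension X h (stone_cech_embed X x) = stone_cech_embed X (h x)"
  using theI'[OF stone_cech_extension_ex1[OF assms]] unfolding stone_cech_extension_def by blast+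

text \<open>Extension is an injective group homomorphism, so it identifies \<open>self_homeos X\<close> with a subgroup
  of \<open>self_homeos (stone_cech X)\<close>.\<close>

lemma self_homeos_compose:
  assumes "g \<in> self_homeos X" "h \<in> self_homeos X"
  shows "compose (topspace X) g h \<in> self_homeos X"
proof -
  have "homeomorphic_map X X (g \<circ> h)"
    using assms homeomorphic_map_compose unfolding self_homeos_def by blast
  then have "homeomorphic_map X X (compose (topspace X) g h)"
    by (rule homeomorphic_map_eq) (simp add: compose_def)
  then show ?thesis by (simp add: self_homeos_def)
qed

lemma stone_cech_extension_compose:
  assumes g: "g \<in> self_homeos X" and h: "h \<in> self_homeos X"
  shows "stone_cech_extension X (compose (topspace X) g h) =
    compose (topspace (stone_cech X)) (stone_cech_extension X g) (stone_cech_extension X h)"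
  unfolding stone_cech_extension_def[of X "compose (topspace X) g h"]
proof (rule the1_equality[OF stone_cech_extension_ex1[OF self_homeos_compose[OF g h]]],
    intro conjI ballI)
  show "compose (topspace (stone_cech X)) (stone_cech_extension X g) (stone_cech_extension X h)
      \<in> self_homeos (stone_cech X)"
    by (intro self_homeos_compose stone_cech_extension_in g h)
  fix x assume x: "x \<in> topspace X"
  then have "h x \<in> topspace X"
    using h homeomorphic_imp_surjective_map unfolding self_homeos_def by blast
  then show "compose (topspace (stone_cech X)) (stone_cech_extension X g) (stone_cech_extension X h)
      (stone_cech_embed X x) = stone_cech_embed X (compose (topspace X) g h x)"
    using x embed_image[of X] stone_cech_extension_embed[OF g] stone_cech_extension_embed[OF h]
    by (auto simp: compose_def)
qed

lemma stone_cech_extension_inj: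
  assumes "completely_regular_space X" "Hausdorff_space X"
  shows "inj_on (stone_cech_extension X) (self_homeos X)"
proof (rule inj_onI)
  fix g h assume g: "g \<in> self_homeos X" and h: "h \<in> self_homeos X"
    and eq: "stone_cech_extension X g = stone_cech_extension X h"
  have inj: "inj_on (stone_cech_embed X) (topspace X)"
    using embedding_stone_cech_embed[OF assms] homeomorphic_imp_injective_map
    unfolding embedding_map_def by blast
  have im: "g ` topspace X = topspace X" "h ` topspace X = topspace X"
    using g h homeomorphic_imp_surjective_map unfolding self_homeos_def by blast+
  have "g x = h x" if x: "x \<in> topspace X" for x
    using stone_cech_extension_embed[OF g x] stone_cech_extension_embed[OF h x] eq
      inj_onD[OF inj] im x by (metis imageI)
  then show "g = h"
    using g h by (intro extensionalityI[of g "topspace X" h]) (auto simp: self_homeos_def)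
qed

end

theory Submission
  imports Defs
begin

text \<open>Write \<open>e\<close> for the embedding of \<open>X\<close> in \<open>\<beta>X\<close> and \<open>h\<^sup>\<beta>\<close> for the extension of \<open>h\<close>. Both topologies
  are generated by sets of the form \<open>{h. h(A) \<subseteq> U}\<close>, and the proof compares the two families.

  Every zero-cozero subbasic set is the trace of a compact-open one. Let \<open>A\<close> and \<open>F\<close> be zero sets.
  If \<open>h(A)\<close> misses \<open>F\<close>, then \<open>h(A)\<close> and \<open>F\<close> are disjoint zero sets, and disjoint zero sets have
  disjoint closures in \<open>\<beta>X\<close> (\<open>disjnt_closures_of_zero_sets\<close>), so \<open>h\<^sup>\<beta>\<close> sends the compact set
  \<open>cl e(A)\<close> into the open set \<open>\<beta>X - cl e(F)\<close>; the converse is immediate. Hence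
  \<open>[A, X - F] = {h. h\<^sup>\<beta> \<in> [cl e(A), \<beta>X - cl e(F)]}\<close> (\<open>zero_cozero_subbasic_eq\<close>).

  The trace of a compact-open subbasic set \<open>[K, V]\<close> need not be zero-cozero subbasic, but it is a
  neighbourhood of each of its points \<open>h\<close> (\<open>zero_cozero_nbhd_within_compact_open\<close>). A Urysohn
  function \<open>\<phi>\<close> on the normal space \<open>\<beta>X\<close>, \<open>0\<close> on \<open>h\<^sup>\<beta>(K)\<close> and \<open>1\<close> off \<open>V\<close>, yields the zero set
  \<open>A = {\<phi> \<circ> h\<^sup>\<beta> \<circ> e \<le> 1/3}\<close>, whose closure contains \<open>K\<close>, and the cozero set
  \<open>U = {\<phi> \<circ> e < 2/3}\<close>, whose closure lies in \<open>V\<close>, with \<open>h \<in> [A, U]\<close>. The gap between the two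
  levels makes the extension of any \<open>k \<in> [A, U]\<close> send \<open>K\<close> into \<open>V\<close>.\<close>

section \<open>Zero sets and cozero sets\<close>

lemma zero_set_in_subset_topspace: "zero_set_in X A \<Longrightarrow> A \<subseteq> topspace X"
  by (auto simp: zero_set_in_def)

lemma zero_set_in_sublevel:
  assumes "continuous_map X euclideanreal f"
  shows "zero_set_in X {x \<in> topspace X. f x \<le> c}"
  unfolding zero_set_in_def
proof (intro exI conjI)
  show "continuous_map X euclideanreal (\<lambda>x. max (f x - c) 0)"
    using assms by (intro continuous_map_real_max continuous_map_diff) auto
  show "{x \<in> topspace X. f x \<le> c} = {x \<in> topspace X. max (f x - c) 0 = 0}"
    by auto
qed

lemma cozero_set_in_strict_sublevel:
  assumes "continuous_map X euclideanreal f"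
  shows "cozero_set_in X {x \<in> topspace X. f x < c}"
  unfolding cozero_set_in_def
proof (intro exI conjI)
  show "zero_set_in X {x \<in> topspace X. - f x \<le> - c}"
    using assms by (intro zero_set_in_sublevel continuous_map_minus)
  show "{x \<in> topspace X. f x < c} = topspace X - {x \<in> topspace X. - f x \<le> - c}"
    by auto
qed

lemma zero_set_in_homeomorphic_image:
  assumes h: "homeomorphic_map X Y h" and A: "zero_set_in X A"
  shows "zero_set_in Y (h ` A)"
proof -
  obtain h' where hh: "homeomorphic_maps X Y h h'"
    using h homeomorphic_map_maps by blast
  obtain f where f: "continuous_map X euclideanreal f" "A = {x \<in> topspace X. f x = 0}"
    using A unfolding zero_set_in_def by blast
  have "continuous_map Y euclideanreal (f \<circ> h')"
    using hh f(1) continuous_map_compose unfolding homeomorphic_maps_def by blast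
  moreover have "h ` A = {y \<in> topspace Y. (f \<circ> h') y = 0}"
    using hh unfolding f(2) homeomorphic_maps_def continuous_map_def Pi_iff
    by (auto simp: image_iff) (metis)
  ultimately show ?thesis
    unfolding zero_set_in_def by blast
qed

text \<open>For \<open>A = {a = 0}\<close> and \<open>F = {b = 0}\<close> the quotient \<open>\<bar>a\<bar> / (\<bar>a\<bar> + \<bar>b\<bar>)\<close> separates the two sets.
  It takes values in \<open>[0,1]\<close>, which is what lets it extend over the compactification below.\<close>

lemma disjnt_zero_sets_separated:
  assumes "zero_set_in X A" "zero_set_in X F" "disjnt A F"
  obtains f where "continuous_map X (top_of_set {0..1::real}) f"
    "\<And>x. x \<in> A \<Longrightarrow> f x = 0" "\<And>x. x \<in> F \<Longrightarrow> f x = 1"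
proof -
  obtain a where a: "continuous_map X euclideanreal a" "A = {x \<in> topspace X. a x = 0}"
    using assms(1) unfolding zero_set_in_def by blast
  obtain b where b: "continuous_map X euclideanreal b" "F = {x \<in> topspace X. b x = 0}"
    using assms(2) unfolding zero_set_in_def by blast
  have pos: "\<bar>a x\<bar> + \<bar>b x\<bar> \<noteq> 0" if "x \<in> topspace X" for x
    using assms(3) that unfolding a(2) b(2) disjnt_iff by auto
  define f where "f = (\<lambda>x. \<bar>a x\<bar> / (\<bar>a x\<bar> + \<bar>b x\<bar>))"
  show ?thesis
  proof
    have "continuous_map X euclideanreal f"
      unfolding f_def
      by (intro continuous_map_real_divide continuous_map_real_abs continuous_map_add a(1) b(1) pos)
    moreover have "f x \<in> {0..1}" for x
      by (auto simp: f_def divide_le_eq_1)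
    ultimately show "continuous_map X (top_of_set {0..1}) f"
      by (simp add: continuous_map_in_subtopology)
    show "f x = 0" if "x \<in> A" for x
      using that by (simp add: a(2) f_def)
    show "f x = 1" if "x \<in> F" for x
      using that pos[of x] by (simp add: b(2) f_def)
  qed
qed

section \<open>Closures in the Stone-Cech compactification\<close>

text \<open>The separating function of two disjoint zero sets extends to \<open>\<beta>X\<close>, and by continuity the
  extension is still \<open>0\<close> on one closure and \<open>1\<close> on the other.\<close>

lemma disjnt_closures_of_zero_sets:
  assumes "zero_set_in X A" "zero_set_in X F" "disjnt A F"
  shows "disjnt (stone_cech X closure_of (stone_cech_embed X ` A))
                (stone_cech X closure_of (stone_cech_embed X ` F))"
proof -
  obtain f where f: "continuous_map X (top_of_set {0..1::real}) f"
    "\<And>x. x \<in> A \<Longrightarrow> f x = 0" "\<And>x. x \<in> F \<Longrightarrow> f x = 1"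
    using disjnt_zero_sets_separated[OF assms] by blast
  obtain g where g: "continuous_map (stone_cech X) (top_of_set {0..1}) g"
    "\<And>x. x \<in> topspace X \<Longrightarrow> g (stone_cech_embed X x) = f x"
    by (rule stone_cech_universal[OF _ _ f(1)])
      (auto simp: compact_space_subtopology Hausdorff_space_subtopology)
  have gr: "continuous_map (stone_cech X) euclideanreal g"
    using g(1) by (simp add: continuous_map_in_subtopology)
  have level: "g p = c"
    if S: "S \<subseteq> topspace X" "\<And>x. x \<in> S \<Longrightarrow> f x = c"
      and p: "p \<in> stone_cech X closure_of (stone_cech_embed X ` S)" for S c p
    by (rule forall_in_closure_of_eq[OF p Hausdorff_space_euclidean gr continuous_map_const[THEN iffD2]])
      (use S g(2) in auto)
  have "g p = 0" if "p \<in> stone_cech X closure_of (stone_cech_embed X ` A)" for p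
    using level[OF zero_set_in_subset_topspace[OF assms(1)] f(2) that] .
  moreover have "g p = 1" if "p \<in> stone_cech X closure_of (stone_cech_embed X ` F)" for p
    using level[OF zero_set_in_subset_topspace[OF assms(2)] f(3) that] .
  ultimately show ?thesis
    unfolding disjnt_iff by force
qed

text \<open>Density of \<open>X\<close> in \<open>\<beta>X\<close>: an open set lies in the closure of its trace on \<open>X\<close>.\<close>

lemma openin_subset_closure_of_trace:
  assumes "openin (stone_cech X) W"
  shows "W \<subseteq> stone_cech X closure_of
    (stone_cech_embed X ` {x \<in> topspace X. stone_cech_embed X x \<in> W})"
proof -
  have "W \<subseteq> W \<inter> stone_cech X closure_of (stone_cech_embed X ` topspace X)"
    using openin_subset[OF assms] by (simp add: dense_stone_cech_embed)
  also have "\<dots> \<subseteq> stone_cech X closure_of (W \<inter> stone_cech_embed X ` topspace X)"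
    by (rule openin_Int_closure_of_subset[OF assms])
  also have "\<dots> \<subseteq> stone_cech X closure_of
      (stone_cech_embed X ` {x \<in> topspace X. stone_cech_embed X x \<in> W})"
    by (rule closure_of_mono) auto
  finally show ?thesis .
qed

lemma self_homeos_image_topspace: "h \<in> self_homeos X \<Longrightarrow> h ` topspace X = topspace X"
  unfolding self_homeos_def by (blast dest: homeomorphic_imp_surjective_map)

lemma continuous_stone_cech_extension:
  "h \<in> self_homeos X \<Longrightarrow> continuous_map (stone_cech X) (stone_cech X) (stone_cech_extension X h)"
  using stone_cech_extension_in[of h X]
  by (auto simp: self_homeos_def intro: homeomorphic_imp_continuous_map)

lemma stone_cech_extension_image_closure:
  assumes "h \<in> self_homeos X" "A \<subseteq> topspace X"
  shows "stone_cech_extension X h ` (stone_cech X closure_of (stone_cech_embed X ` A))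
    \<subseteq> stone_cech X closure_of (stone_cech_embed X ` h ` A)"
proof -
  have "stone_cech_extension X h ` stone_cech_embed X ` A = stone_cech_embed X ` h ` A"
    using assms(2) stone_cech_extension_embed[OF assms(1)] unfolding image_image
    by (intro image_cong) auto
  then show ?thesis
    using continuous_map_image_closure_subset[OF continuous_stone_cech_extension[OF assms(1)]]
    by metis
qed

section \<open>Comparison of the two subbases\<close>

text \<open>Since \<open>h\<close> is a homeomorphism, \<open>h(A)\<close> is again a zero set, so disjointness of \<open>h(A)\<close> and
  \<open>F\<close> in \<open>X\<close> persists for their closures in \<open>\<beta>X\<close>; the closure of \<open>e(h(A))\<close> contains the image of
  the closure of \<open>e(A)\<close> by continuity of the extension.\<close>

lemma zero_cozero_subbasic_eq:
  assumes A: "zero_set_in X A" and F: "zero_set_in X F" and h: "h \<in> self_homeos X"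
  shows "h ` A \<subseteq> topspace X - F \<longleftrightarrow>
    stone_cech_extension X h ` (stone_cech X closure_of (stone_cech_embed X ` A))
      \<subseteq> topspace (stone_cech X) - stone_cech X closure_of (stone_cech_embed X ` F)"
    (is "?L \<longleftrightarrow> ?R")
proof
  note AX = zero_set_in_subset_topspace[OF A] and FX = zero_set_in_subset_topspace[OF F]
  have hA: "zero_set_in X (h ` A)"
    using zero_set_in_homeomorphic_image[OF _ A] h unfolding self_homeos_def by blast
  show ?R if ?L
  proof -
    have "disjnt (h ` A) F"
      using \<open>?L\<close> unfolding disjnt_iff by blast
    then have "disjnt (stone_cech X closure_of (stone_cech_embed X ` h ` A))
        (stone_cech X closure_of (stone_cech_embed X ` F))"
      by (rule disjnt_closures_of_zero_sets[OF hA F])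
    then show ?thesis
      using stone_cech_extension_image_closure[OF h AX]
        closure_of_subset_topspace[of "stone_cech X" "stone_cech_embed X ` h ` A"]
      unfolding disjnt_iff by blast
  qed
  have cl: "stone_cech_embed X x \<in> stone_cech X closure_of (stone_cech_embed X ` S)"
    if "x \<in> S" "S \<subseteq> topspace X" for x S
    using closure_of_subset[of "stone_cech_embed X ` S" "stone_cech X"] embed_image[of X] that
    by blast
  show ?L if ?R
  proof (intro image_subsetI DiffI)
    fix x assume x: "x \<in> A"
    then show "h x \<in> topspace X"
      using AX self_homeos_image_topspace[OF h] by blast
    show "h x \<notin> F"
    proof
      assume "h x \<in> F"
      then have "stone_cech_embed X (h x) \<in> stone_cech X closure_of (stone_cech_embed X ` F)"
        using cl FX by blast
      moreover have "stone_cech_extension X h (stone_cech_embed X x) = stone_cech_embed X (h x)"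
        using stone_cech_extension_embed[OF h] x AX by blast
      moreover have "stone_cech_embed X x \<in> stone_cech X closure_of (stone_cech_embed X ` A)"
        by (rule cl[OF x AX])
      ultimately show False
        using \<open>?R\<close> by (metis DiffD2 image_subset_iff)
    qed
  qed
qed

text \<open>Compactness of \<open>K\<close> makes its image closed, so a Urysohn function can separate it from the
  complement of \<open>V\<close>. Two different levels \<open>1/3 < 2/3\<close> are used because passing to closures turns
  strict inequalities into weak ones: there is room below \<open>1/3\<close> for an open set around \<open>K\<close>, and
  the weak bound \<open>2/3\<close> still keeps points out of the level set \<open>{\<phi> = 1}\<close>.\<close>

lemma zero_cozero_nbhd_within_compact_open:
  assumes K: "compactin (stone_cech X) K" and V: "openin (stone_cech X) V"
    and h: "h \<in> self_homeos X" and hKV: "stone_cech_extension X h ` K \<subseteq> V"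
  obtains A U where "zero_set_in X A" "cozero_set_in X U" "h ` A \<subseteq> U"
    "\<And>k. k \<in> self_homeos X \<Longrightarrow> k ` A \<subseteq> U \<Longrightarrow> stone_cech_extension X k ` K \<subseteq> V"
proof -
  let ?B = "stone_cech X" and ?e = "stone_cech_embed X" and ?g = "stone_cech_extension X h"
  note g = continuous_stone_cech_extension[OF h]
  have KB: "K \<subseteq> topspace ?B"
    using K by (rule compactin_subset_topspace)
  have normal: "normal_space ?B"
    using compact_stone_cech Hausdorff_stone_cech compact_Hausdorff_or_regular_imp_normal_space
    by blast
  have cK: "closedin ?B (?g ` K)"
    by (rule compactin_imp_closedin[OF Hausdorff_stone_cech image_compactin[OF K g]])
  have cV: "closedin ?B (topspace ?B - V)"
    using V by blast
  have disj: "disjnt (?g ` K) (topspace ?B - V)"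
    using hKV unfolding disjnt_iff by blast
  obtain \<phi> where "continuous_map ?B (top_of_set {0..1::real}) \<phi>"
    and \<phi>0: "\<phi> ` ?g ` K \<subseteq> {0}" and \<phi>1: "\<phi> ` (topspace ?B - V) \<subseteq> {1}"
    using Urysohn_lemma[OF normal cK cV disj zero_le_one] by blast
  then have \<phi>: "continuous_map ?B euclideanreal \<phi>"
    by (simp add: continuous_map_in_subtopology)
  have \<phi>g: "continuous_map ?B euclideanreal (\<lambda>p. \<phi> (?g p))"
    using continuous_map_compose[OF g \<phi>] by (simp add: comp_def)
  define A where "A = {x \<in> topspace X. \<phi> (?g (?e x)) \<le> 1/3}"
  define U where "U = {x \<in> topspace X. \<phi> (?e x) < 2/3}"
  show ?thesis
  proof
    show "zero_set_in X A"
      unfolding A_def using continuous_map_compose[OF continuous_stone_cech_embed \<phi>g]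
      by (intro zero_set_in_sublevel) (simp add: comp_def)
    show "cozero_set_in X U"
      unfolding U_def using continuous_map_compose[OF continuous_stone_cech_embed \<phi>]
      by (intro cozero_set_in_strict_sublevel) (simp add: comp_def)
    show "h ` A \<subseteq> U"
      using stone_cech_extension_embed[OF h] self_homeos_image_topspace[OF h]
      unfolding A_def U_def by auto
    fix k assume k: "k \<in> self_homeos X" and kAU: "k ` A \<subseteq> U"
    \<comment> \<open>The open set \<open>{\<phi> \<circ> g < 1/3}\<close> contains \<open>K\<close>, and its trace on \<open>X\<close> lies in \<open>A\<close>.\<close>
    define W where "W = {p \<in> topspace ?B. \<phi> (?g p) \<in> {..<1/3}}"
    have "openin ?B W"
      unfolding W_def by (rule openin_continuous_map_preimage[OF \<phi>g]) auto
    then have "W \<subseteq> ?B closure_of (?e ` {x \<in> topspace X. ?e x \<in> W})"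
      by (rule openin_subset_closure_of_trace)
    also have "\<dots> \<subseteq> ?B closure_of (?e ` A)"
      by (intro closure_of_mono image_mono) (auto simp: W_def A_def)
    finally have "K \<subseteq> ?B closure_of (?e ` A)"
      using KB \<phi>0 unfolding W_def by force
    then have "stone_cech_extension X k ` K \<subseteq> stone_cech_extension X k ` (?B closure_of (?e ` A))"
      by (rule image_mono)
    also have "\<dots> \<subseteq> ?B closure_of (?e ` k ` A)"
      by (rule stone_cech_extension_image_closure[OF k]) (auto simp: A_def)
    also have "\<dots> \<subseteq> {p \<in> topspace ?B. \<phi> p \<in> {..2/3}}"
    proof (rule closure_of_minimal)
      show "closedin ?B {p \<in> topspace ?B. \<phi> p \<in> {..2/3}}"
        by (rule closedin_continuous_map_preimage[OF \<phi>]) auto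
      show "?e ` k ` A \<subseteq> {p \<in> topspace ?B. \<phi> p \<in> {..2/3}}"
        using kAU embed_image[of X] unfolding U_def by force
    qed
    also have "\<dots> \<subseteq> V"
      using \<phi>1 by force
    finally show "stone_cech_extension X k ` K \<subseteq> V" .
  qed
qed

lemma continuous_stone_cech_extension_map:
  "continuous_map (zero_cozero_topology X) (compact_open_topology (stone_cech X))
    (stone_cech_extension X)"
  unfolding compact_open_topology_def continuous_on_generated_topo_iff topspace_zero_cozero_topology
proof (intro conjI allI impI)
  let ?S = "{{h \<in> self_homeos (stone_cech X). h ` K \<subseteq> V} |K V.
    compactin (stone_cech X) K \<and> openin (stone_cech X) V}"
  show "stone_cech_extension X ` self_homeos X \<subseteq> \<Union> ?S"
    using stone_cech_extension_in topspace_compact_open_topology[of "stone_cech X"]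
    unfolding compact_open_topology_def topology_generated_by_topspace by blast
  fix \<W> assume "\<W> \<in> ?S"
  then obtain K V where K: "compactin (stone_cech X) K" and V: "openin (stone_cech X) V"
    and \<W>: "\<W> = {h \<in> self_homeos (stone_cech X). h ` K \<subseteq> V}"
    by blast
  have "\<exists>T. openin (zero_cozero_topology X) T \<and> h \<in> T
      \<and> T \<subseteq> stone_cech_extension X -` \<W> \<inter> self_homeos X"
    if "h \<in> stone_cech_extension X -` \<W> \<inter> self_homeos X" for h
  proof -
    have h: "h \<in> self_homeos X" "stone_cech_extension X h ` K \<subseteq> V"
      using that by (auto simp: \<W>)
    obtain A U where AU: "zero_set_in X A" "cozero_set_in X U" "h ` A \<subseteq> U"
      and sub: "\<And>k. k \<in> self_homeos X \<Longrightarrow> k ` A \<subseteq> U \<Longrightarrow> stone_cech_extension X k ` K \<subseteq> V"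
      using zero_cozero_nbhd_within_compact_open[OF K V h] by metis
    have "openin (zero_cozero_topology X) {k \<in> self_homeos X. k ` A \<subseteq> U}"
      unfolding zero_cozero_topology_def using AU by (intro topology_generated_by_Basis) blast
    moreover have "{k \<in> self_homeos X. k ` A \<subseteq> U} \<subseteq> stone_cech_extension X -` \<W> \<inter> self_homeos X"
      using sub stone_cech_extension_in[of _ X] unfolding \<W> by blast
    ultimately show ?thesis
      using AU(3) h(1) by blast
  qed
  then show "openin (zero_cozero_topology X) (stone_cech_extension X -` \<W> \<inter> self_homeos X)"
    by (subst openin_subopen) blast
qed

lemma openin_pullback_zero_cozero_subbasic:
  assumes A: "zero_set_in X A" and U: "cozero_set_in X U"
  shows "openin (pullback_topology (self_homeos X) (stone_cech_extension X)
    (compact_open_topology (stone_cech X))) {h \<in> self_homeos X. h ` A \<subseteq> U}"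
proof -
  obtain F where F: "zero_set_in X F" "U = topspace X - F"
    using U unfolding cozero_set_in_def by blast
  define K where "K = stone_cech X closure_of (stone_cech_embed X ` A)"
  define V where "V = topspace (stone_cech X) - stone_cech X closure_of (stone_cech_embed X ` F)"
  have "compactin (stone_cech X) K"
    unfolding K_def using closedin_compact_space[OF compact_stone_cech] closedin_closure_of by blast
  moreover have "openin (stone_cech X) V"
    unfolding V_def by (intro openin_diff openin_topspace closedin_closure_of)
  ultimately have "openin (compact_open_topology (stone_cech X))
      {g \<in> self_homeos (stone_cech X). g ` K \<subseteq> V}"
    unfolding compact_open_topology_def by (intro topology_generated_by_Basis) blast
  moreover have "{h \<in> self_homeos X. h ` A \<subseteq> U} =
      stone_cech_extension X -` {g \<in> self_homeos (stone_cech X). g ` K \<subseteq> V} \<inter> self_homeos X"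
    using zero_cozero_subbasic_eq[OF A F(1)] stone_cech_extension_in[of _ X]
    unfolding K_def V_def F(2) by blast
  ultimately show ?thesis
    unfolding openin_pullback_topology by blast
qed

theorem theorem4p1:
  fixes X :: "'a topology"
  assumes "completely_regular_space X" and "Hausdorff_space X"
  shows "zero_cozero_topology X =
    pullback_topology (self_homeos X) (stone_cech_extension X) (compact_open_topology (stone_cech X))"
  (is "_ = ?P")
proof (rule topology_eq[THEN iffD2], intro allI iffI)
  fix S
  show "openin ?P S" if "openin (zero_cozero_topology X) S"
    by (rule generate_topology_on_coarsest[OF istopology_openin _
          openin_topology_generated_by[OF that[unfolded zero_cozero_topology_def]]])
      (blast intro: openin_pullback_zero_cozero_subbasic)
  show "openin (zero_cozero_topology X) S" if "openin ?P S"
    using that continuous_stone_cech_extension_map[of X]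
    unfolding openin_pullback_topology continuous_map_alt topspace_zero_cozero_topology by blast
qed

end
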